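(* Let $R$ be a commutative ring with unity. There is an isomorphism of $R$-algebras $$\mathcal F^f(\mathbb Q_+^*,R)\cong R[[x_1,x_2,\ldots]][x_1^{-1},x_2^{-1},\ldots].$$
   Context: $\mathbb N^*$ is the multiplicative monoid of positive integers and $\mathbb Q_+^*$ the multiplicative group of positive rational numbers. $\mathcal F^f(\mathbb Q_+^*,R)$ is the set of functions $\alpha:\mathbb Q_+^*\to R$ for which there is $d\in\mathbb N^*$ such that for all $q\in\mathbb Q_+^*$, $\alpha(q)\ne0$ implies $dq\in\mathbb N^*$; it is a commutative $R$-algebra under pointwise addition and scalar multiplication and the product $(\alpha\cdot\beta)(q)=\sum_{q'q''=q}\alpha(q')\beta(q'')$ (a sum with finitely many nonzero terms). $R[[x_1,x_2,\ldots]]=\varprojlim_k R[[x_1,\ldots,x_k]]$ (transition maps sending the last variable to $0$) is the ring of formal power series in countably many variables, i.e. all formal, possibly infinite, $R$-linear combinations of monomials $x_1^{a_1}\cdots x_r^{a_r}$ (each involving finitely many variables). $R[[x_1,x_2,\ldots]][x_1^{-1},x_2^{-1},\ldots]$ is its localization at the multiplicative set of all monomials. *)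

theory Defs
  imports Complex_Main "HOL-Algebra.QuotRing" "HOL-Algebra.Module" "HOL-Library.Poly_Mapping"
begin

definition algebra_iso ::
  "('a, 'm) ring_scheme \<Rightarrow> ('a, 'b, 'n) module_scheme \<Rightarrow> ('a, 'c, 'p) module_scheme \<Rightarrow> ('b \<Rightarrow> 'c) set"
  where "algebra_iso R A B =
    {\<phi> \<in> ring_iso A B. \<forall>r\<in>carrier R. \<forall>x\<in>carrier A. \<phi> (r \<odot>\<^bsub>A\<^esub> x) = r \<odot>\<^bsub>B\<^esub> \<phi> x}"

(* F^f(Q_+^*, R).  A function on the positive rationals is an extensional function on {0<..}.
   The product ranges over the pairs (q', q'') with nonzero term; on the carrier there are
   finitely many of them, which matters because finsum over an infinite set is zero. *)
definition rat_fun_algebra :: "('a, 'm) ring_scheme \<Rightarrow> ('a, rat \<Rightarrow> 'a) module"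
  where "rat_fun_algebra R =
    \<lparr>carrier = {\<alpha> \<in> {0<..} \<rightarrow>\<^sub>E carrier R.
       \<exists>d::nat. 0 < d \<and>
         (\<forall>q\<in>{0<..}. \<alpha> q \<noteq> \<zero>\<^bsub>R\<^esub> \<longrightarrow> (\<exists>n::nat. 0 < n \<and> of_nat d * q = of_nat n))},
     mult = (\<lambda>\<alpha> \<beta>. \<lambda>q\<in>{0<..}. \<Oplus>\<^bsub>R\<^esub>p\<in>{p \<in> {0<..} \<times> {0<..}.
       fst p * snd p = q \<and> \<alpha> (fst p) \<otimes>\<^bsub>R\<^esub> \<beta> (snd p) \<noteq> \<zero>\<^bsub>R\<^esub>}. \<alpha> (fst p) \<otimes>\<^bsub>R\<^esub> \<beta> (snd p)),
     one = (\<lambda>q\<in>{0<..}. if q = 1 then \<one>\<^bsub>R\<^esub> else \<zero>\<^bsub>R\<^esub>),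
     zero = (\<lambda>q\<in>{0<..}. \<zero>\<^bsub>R\<^esub>),
     add = (\<lambda>\<alpha> \<beta>. \<lambda>q\<in>{0<..}. \<alpha> q \<oplus>\<^bsub>R\<^esub> \<beta> q),
     smult = (\<lambda>r \<alpha>. \<lambda>q\<in>{0<..}. r \<otimes>\<^bsub>R\<^esub> \<alpha> q)\<rparr>"

(* R[[x_1, x_2, ...]].  A monomial is its exponent vector, a finitely supported function
   nat \<Rightarrow>\<^sub>0 nat whose value at i is the exponent of x_{i+1}, and a power series is its
   coefficient function on the set of all monomials, without any support condition (so that
   x_1 + x_2 + ... is a power series).  Restricting to the monomials in x_1, ..., x_k sets
   the remaining variables to zero, which gives the projections of the inverse limit. *)
definition powser_algebra :: "('a, 'm) ring_scheme \<Rightarrow> ('a, (nat \<Rightarrow>\<^sub>0 nat) \<Rightarrow> 'a) module"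
  where "powser_algebra R =
    \<lparr>carrier = UNIV \<rightarrow> carrier R,
     mult = (\<lambda>f g. \<lambda>m. \<Oplus>\<^bsub>R\<^esub>p\<in>{p. fst p + snd p = m}. f (fst p) \<otimes>\<^bsub>R\<^esub> g (snd p)),
     one = (\<lambda>m. if m = 0 then \<one>\<^bsub>R\<^esub> else \<zero>\<^bsub>R\<^esub>),
     zero = (\<lambda>m. \<zero>\<^bsub>R\<^esub>),
     add = (\<lambda>f g. \<lambda>m. f m \<oplus>\<^bsub>R\<^esub> g m),
     smult = (\<lambda>r f. \<lambda>m. r \<otimes>\<^bsub>R\<^esub> f m)\<rparr>"

definition monomials :: "('a, 'm) ring_scheme \<Rightarrow> ((nat \<Rightarrow>\<^sub>0 nat) \<Rightarrow> 'a) set"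
  where "monomials R = range (\<lambda>n. \<lambda>m. if m = n then \<one>\<^bsub>R\<^esub> else \<zero>\<^bsub>R\<^esub>)"

(* Localization of a commutative algebra A at a multiplicative subset S of its carrier.
   As in any localization of a ring that may have zero divisors, a/s = b/t means
   u (t a - s b) = 0 for some u in S. *)
definition loc_rel :: "('b, 'm) ring_scheme \<Rightarrow> 'b set \<Rightarrow> (('b \<times> 'b) \<times> ('b \<times> 'b)) set"
  where "loc_rel A S =
    {((a, s), (b, t)). a \<in> carrier A \<and> b \<in> carrier A \<and> s \<in> S \<and> t \<in> S \<and>
       (\<exists>u\<in>S. u \<otimes>\<^bsub>A\<^esub> (t \<otimes>\<^bsub>A\<^esub> a \<ominus>\<^bsub>A\<^esub> s \<otimes>\<^bsub>A\<^esub> b) = \<zero>\<^bsub>A\<^esub>)}"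

definition loc_frac :: "('b, 'm) ring_scheme \<Rightarrow> 'b set \<Rightarrow> 'b \<Rightarrow> 'b \<Rightarrow> ('b \<times> 'b) set"
  where "loc_frac A S a s = loc_rel A S `` {(a, s)}"

(* Each union below is over representatives that all give the same class. *)
definition localization ::
  "('a, 'b, 'm) module_scheme \<Rightarrow> 'b set \<Rightarrow> ('a, ('b \<times> 'b) set) module"
  where "localization A S =
    \<lparr>carrier = (carrier A \<times> S) // loc_rel A S,
     mult = (\<lambda>X Y. \<Union>(a, s)\<in>X. \<Union>(b, t)\<in>Y. loc_frac A S (a \<otimes>\<^bsub>A\<^esub> b) (s \<otimes>\<^bsub>A\<^esub> t)),
     one = loc_frac A S \<one>\<^bsub>A\<^esub> \<one>\<^bsub>A\<^esub>,
     zero = loc_frac A S \<zero>\<^bsub>A\<^esub> \<one>\<^bsub>A\<^esub>,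
     add = (\<lambda>X Y. \<Union>(a, s)\<in>X. \<Union>(b, t)\<in>Y.
       loc_frac A S (t \<otimes>\<^bsub>A\<^esub> a \<oplus>\<^bsub>A\<^esub> s \<otimes>\<^bsub>A\<^esub> b) (s \<otimes>\<^bsub>A\<^esub> t)),
     smult = (\<lambda>r X. \<Union>(a, s)\<in>X. loc_frac A S (r \<odot>\<^bsub>A\<^esub> a) s)\<rparr>"

end

theory Submission
  imports Defs "HOL-Computational_Algebra.Primes" "HOL-Library.Infinite_Set"
begin

text \<open>
  Unique factorization makes the monomials in \<open>x\<^sub>1, x\<^sub>2, \<dots>\<close> a copy of the multiplicative
  monoid of positive integers: the monomial with exponent vector \<open>m\<close> corresponds to
  \<open>prime_val m\<close>, the product of the powers \<open>p\<^sub>i ^ m\<^sub>i\<close> over the sequence of all primes.  A power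
  series is therefore the same thing as a function on the positive integers, and its product is
  Dirichlet convolution.  Extending such a function by zero to the positive rationals embeds the
  power series ring into \<open>\<F> = rat_fun_algebra R\<close> as the functions supported on the integers
  (\<open>embed\<close>).

  A monomial goes to the characteristic function \<open>delta n\<close> of a positive integer \<open>n\<close>, which is
  a unit of \<open>\<F>\<close> with inverse \<open>delta (1 / n)\<close>.  Convolution with \<open>delta d\<close> translates
  the support by \<open>d\<close>, so if \<open>d\<close> is a common denominator of the support of \<open>\<alpha>\<close>, then
  \<open>delta d \<cdot> \<alpha>\<close> is supported on the integers: every element of \<open>\<F>\<close> becomes a power series
  after multiplication by a monomial (\<open>clear_denominator\<close>).  An injective homomorphism with
  these two properties identifies its target with the localization (\<open>localization_iso\<close>).

  Only \<open>\<F>\<close> is shown to be an algebra by computation.  Its product is evaluated as a sum over any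
  finite set that contains the support of the summand (\<open>mult_eq_finsum\<close>), which reduces
  associativity to exchanging two finite sums.  The power series ring inherits the axioms along
  \<open>embed\<close>, and the localization along its identification with \<open>\<F>\<close>
  (\<open>algebra_pullback\<close>).
\<close>

section \<open>Transport of algebra structures\<close>

text \<open>
  The algebra axioms pass to a structure \<open>A\<close> that is embedded in an algebra and closed under the
  operations.  Negatives need no hypothesis, because they are multiples by the scalar \<open>\<ominus> \<one>\<close>.
\<close>

lemma algebra_pullback:
  fixes R (structure) and A (structure) and B (structure)
  assumes B: "algebra R B"
    and h: "\<And>x. x \<in> carrier A \<Longrightarrow> h x \<in> carrier B"
    and inj: "inj_on h (carrier A)"
    and closed: "\<one>\<^bsub>A\<^esub> \<in> carrier A" "\<zero>\<^bsub>A\<^esub> \<in> carrier A"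
      "\<And>x y. x \<in> carrier A \<Longrightarrow> y \<in> carrier A \<Longrightarrow> x \<oplus>\<^bsub>A\<^esub> y \<in> carrier A"
      "\<And>x y. x \<in> carrier A \<Longrightarrow> y \<in> carrier A \<Longrightarrow> x \<otimes>\<^bsub>A\<^esub> y \<in> carrier A"
      "\<And>r x. r \<in> carrier R \<Longrightarrow> x \<in> carrier A \<Longrightarrow> r \<odot>\<^bsub>A\<^esub> x \<in> carrier A"
    and hom: "h \<one>\<^bsub>A\<^esub> = \<one>\<^bsub>B\<^esub>" "h \<zero>\<^bsub>A\<^esub> = \<zero>\<^bsub>B\<^esub>"
      "\<And>x y. x \<in> carrier A \<Longrightarrow> y \<in> carrier A \<Longrightarrow> h (x \<oplus>\<^bsub>A\<^esub> y) = h x \<oplus>\<^bsub>B\<^esub> h y"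
      "\<And>x y. x \<in> carrier A \<Longrightarrow> y \<in> carrier A \<Longrightarrow> h (x \<otimes>\<^bsub>A\<^esub> y) = h x \<otimes>\<^bsub>B\<^esub> h y"
      "\<And>r x. r \<in> carrier R \<Longrightarrow> x \<in> carrier A \<Longrightarrow> h (r \<odot>\<^bsub>A\<^esub> x) = r \<odot>\<^bsub>B\<^esub> h x"
  shows "algebra R A"
proof -
  interpret B: algebra R B by fact
  have eqI: "x = y" if "h x = h y" "x \<in> carrier A" "y \<in> carrier A" for x y
    using inj that by (auto dest: inj_onD)
  note [simp] = closed hom h
  have neg: "\<exists>y\<in>carrier A. y \<oplus>\<^bsub>A\<^esub> x = \<zero>\<^bsub>A\<^esub>" if x: "x \<in> carrier A" for x
  proof (intro bexI)
    show "(\<ominus> \<one>) \<odot>\<^bsub>A\<^esub> x \<oplus>\<^bsub>A\<^esub> x = \<zero>\<^bsub>A\<^esub>"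
      by (rule eqI) (use x in \<open>simp_all add: B.smult_l_minus B.M.l_neg\<close>)
  qed (use x in simp)
  have "abelian_group A"
  proof (rule abelian_groupI)
    fix x y z assume x: "x \<in> carrier A" "y \<in> carrier A" "z \<in> carrier A"
    show "x \<oplus>\<^bsub>A\<^esub> y \<oplus>\<^bsub>A\<^esub> z = x \<oplus>\<^bsub>A\<^esub> (y \<oplus>\<^bsub>A\<^esub> z)"
      by (rule eqI) (use x in \<open>simp_all add: B.M.a_assoc\<close>)
  next
    fix x y assume x: "x \<in> carrier A" "y \<in> carrier A"
    show "x \<oplus>\<^bsub>A\<^esub> y = y \<oplus>\<^bsub>A\<^esub> x"
      by (rule eqI) (use x in \<open>simp_all add: B.M.a_comm\<close>)
  next
    fix x assume x: "x \<in> carrier A"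
    show "\<zero>\<^bsub>A\<^esub> \<oplus>\<^bsub>A\<^esub> x = x"
      by (rule eqI) (use x in simp_all)
  qed (use neg in auto)
  moreover have "Group.comm_monoid A"
  proof (rule comm_monoidI)
    fix x y z assume x: "x \<in> carrier A" "y \<in> carrier A" "z \<in> carrier A"
    show "x \<otimes>\<^bsub>A\<^esub> y \<otimes>\<^bsub>A\<^esub> z = x \<otimes>\<^bsub>A\<^esub> (y \<otimes>\<^bsub>A\<^esub> z)"
      by (rule eqI) (use x in \<open>simp_all add: B.m_assoc\<close>)
  next
    fix x y assume x: "x \<in> carrier A" "y \<in> carrier A"
    show "x \<otimes>\<^bsub>A\<^esub> y = y \<otimes>\<^bsub>A\<^esub> x"
      by (rule eqI) (use x in \<open>simp_all add: B.m_comm\<close>)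
  next
    fix x assume x: "x \<in> carrier A"
    show "\<one>\<^bsub>A\<^esub> \<otimes>\<^bsub>A\<^esub> x = x"
      by (rule eqI) (use x in simp_all)
  qed auto
  ultimately have "cring A"
  proof (rule cringI)
    fix x y z assume x: "x \<in> carrier A" "y \<in> carrier A" "z \<in> carrier A"
    show "(x \<oplus>\<^bsub>A\<^esub> y) \<otimes>\<^bsub>A\<^esub> z = x \<otimes>\<^bsub>A\<^esub> z \<oplus>\<^bsub>A\<^esub> y \<otimes>\<^bsub>A\<^esub> z"
      by (rule eqI) (use x in \<open>simp_all add: B.l_distr\<close>)
  qed
  with B.R_cring show ?thesis
  proof (rule algebraI)
    fix a b x assume x: "a \<in> carrier R" "b \<in> carrier R" "x \<in> carrier A"
    show "(a \<oplus> b) \<odot>\<^bsub>A\<^esub> x = a \<odot>\<^bsub>A\<^esub> x \<oplus>\<^bsub>A\<^esub> b \<odot>\<^bsub>A\<^esub> x"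
      by (rule eqI) (use x in \<open>simp_all add: B.smult_l_distr\<close>)
    show "(a \<otimes> b) \<odot>\<^bsub>A\<^esub> x = a \<odot>\<^bsub>A\<^esub> (b \<odot>\<^bsub>A\<^esub> x)"
      by (rule eqI) (use x in \<open>simp_all add: B.smult_assoc1\<close>)
  next
    fix a x y assume x: "a \<in> carrier R" "x \<in> carrier A" "y \<in> carrier A"
    show "a \<odot>\<^bsub>A\<^esub> (x \<oplus>\<^bsub>A\<^esub> y) = a \<odot>\<^bsub>A\<^esub> x \<oplus>\<^bsub>A\<^esub> a \<odot>\<^bsub>A\<^esub> y"
      by (rule eqI) (use x in \<open>simp_all add: B.smult_r_distr\<close>)
    show "(a \<odot>\<^bsub>A\<^esub> x) \<otimes>\<^bsub>A\<^esub> y = a \<odot>\<^bsub>A\<^esub> (x \<otimes>\<^bsub>A\<^esub> y)"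
      by (rule eqI) (use x in \<open>simp_all add: B.smult_assoc2\<close>)
  next
    fix x assume x: "x \<in> carrier A"
    show "\<one> \<odot>\<^bsub>A\<^esub> x = x"
      by (rule eqI) (use x in simp_all)
  qed auto
qed

section \<open>Recognizing a localization\<close>

lemma UN_case_prod_eq_const:
  assumes "X \<noteq> {}" "\<And>a s. (a, s) \<in> X \<Longrightarrow> f a s = C"
  shows "(\<Union>(a, s)\<in>X. f a s) = C"
  using assms by fastforce

text \<open>
  A recognition criterion: \<open>h\<close> embeds \<open>A\<close> in \<open>B\<close>, makes \<open>S\<close> invertible, and every element
  of \<open>B\<close> is a fraction \<open>h a / h s\<close>.  That the localization is an algebra is a conclusion: it is a
  relabelling of \<open>B\<close> in which \<open>x\<close> becomes the set \<open>\<Phi> x\<close> of all the fractions that represent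
  it.
\<close>

lemma localization_iso:
  fixes R (structure) and A (structure) and B (structure) and S
  assumes A: "algebra R A" and B: "algebra R B"
    and h: "h \<in> ring_hom A B" and inj: "inj_on h (carrier A)"
    and h_smult: "\<And>r x. r \<in> carrier R \<Longrightarrow> x \<in> carrier A \<Longrightarrow> h (r \<odot>\<^bsub>A\<^esub> x) = r \<odot>\<^bsub>B\<^esub> h x"
    and S: "S \<subseteq> carrier A" "\<one>\<^bsub>A\<^esub> \<in> S" "\<And>s t. s \<in> S \<Longrightarrow> t \<in> S \<Longrightarrow> s \<otimes>\<^bsub>A\<^esub> t \<in> S"
    and units: "\<And>s. s \<in> S \<Longrightarrow> h s \<in> Units B"
    and denom: "\<And>x. x \<in> carrier B \<Longrightarrow> \<exists>s\<in>S. \<exists>a\<in>carrier A. h a = h s \<otimes>\<^bsub>B\<^esub> x"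
  shows "algebra R (localization A S)"
    and "\<exists>\<phi>. \<phi> \<in> algebra_iso R B (localization A S)"
proof -
  interpret A: algebra R A by fact
  interpret B: algebra R B by fact
  interpret h: ring_hom_cring A B h
    by unfold_locales (rule h)
  define L where "L = localization A S"
  define \<Phi> where "\<Phi> x = {(a, s). a \<in> carrier A \<and> s \<in> S \<and> h a = h s \<otimes>\<^bsub>B\<^esub> x}" for x
  have SA [simp]: "s \<in> carrier A" if "s \<in> S" for s
    using S that by auto
  note [simp] = units S(2,3) h_smult
  have cancel: "h s \<otimes>\<^bsub>B\<^esub> x = h s \<otimes>\<^bsub>B\<^esub> y \<longleftrightarrow> x = y"
    if "s \<in> S" "x \<in> carrier B" "y \<in> carrier B" for s x y
    using that by (meson B.Units_l_cancel units)
  have hz: "h x = \<zero>\<^bsub>B\<^esub> \<longleftrightarrow> x = \<zero>\<^bsub>A\<^esub>" if "x \<in> carrier A" for x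
    using inj_onD[OF inj, of x "\<zero>\<^bsub>A\<^esub>"] that by auto
  \<comment> \<open>The factor \<open>u\<close> in the definition of the relation is irrelevant, because \<open>h u\<close> is a unit
    of \<open>B\<close> and \<open>h\<close> is injective.\<close>
  have rel: "((a, s), (b, t)) \<in> loc_rel A S \<longleftrightarrow>
      a \<in> carrier A \<and> b \<in> carrier A \<and> s \<in> S \<and> t \<in> S \<and> h t \<otimes>\<^bsub>B\<^esub> h a = h s \<otimes>\<^bsub>B\<^esub> h b" for a s b t
  proof -
    have "u \<otimes>\<^bsub>A\<^esub> (t \<otimes>\<^bsub>A\<^esub> a \<ominus>\<^bsub>A\<^esub> s \<otimes>\<^bsub>A\<^esub> b) = \<zero>\<^bsub>A\<^esub> \<longleftrightarrow> h t \<otimes>\<^bsub>B\<^esub> h a = h s \<otimes>\<^bsub>B\<^esub> h b"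
      if as: "a \<in> carrier A" "b \<in> carrier A" "s \<in> S" "t \<in> S" "u \<in> S" for u
    proof -
      have "u \<otimes>\<^bsub>A\<^esub> (t \<otimes>\<^bsub>A\<^esub> a \<ominus>\<^bsub>A\<^esub> s \<otimes>\<^bsub>A\<^esub> b) = \<zero>\<^bsub>A\<^esub> \<longleftrightarrow>
          h (u \<otimes>\<^bsub>A\<^esub> (t \<otimes>\<^bsub>A\<^esub> a \<ominus>\<^bsub>A\<^esub> s \<otimes>\<^bsub>A\<^esub> b)) = \<zero>\<^bsub>B\<^esub>"
        using as by (subst hz) auto
      also have "\<dots> \<longleftrightarrow> h u \<otimes>\<^bsub>B\<^esub> (h t \<otimes>\<^bsub>B\<^esub> h a \<ominus>\<^bsub>B\<^esub> h s \<otimes>\<^bsub>B\<^esub> h b) = h u \<otimes>\<^bsub>B\<^esub> \<zero>\<^bsub>B\<^esub>"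
        using as by (simp add: a_minus_def)
      also have "\<dots> \<longleftrightarrow> h t \<otimes>\<^bsub>B\<^esub> h a \<ominus>\<^bsub>B\<^esub> h s \<otimes>\<^bsub>B\<^esub> h b = \<zero>\<^bsub>B\<^esub>"
        using as by (subst cancel) auto
      also have "\<dots> \<longleftrightarrow> h t \<otimes>\<^bsub>B\<^esub> h a = h s \<otimes>\<^bsub>B\<^esub> h b"
        using as by (auto simp: a_minus_def B.M.r_neg dest: B.M.minus_equality[symmetric])
      finally show ?thesis .
    qed
    then show ?thesis
      using S(2) unfolding loc_rel_def by auto
  qed
  have frac: "loc_frac A S a s = \<Phi> x"
    if "a \<in> carrier A" "s \<in> S" "x \<in> carrier B" "h a = h s \<otimes>\<^bsub>B\<^esub> x" for a s x
  proof -
    have *: "h t \<otimes>\<^bsub>B\<^esub> h a = h s \<otimes>\<^bsub>B\<^esub> h b \<longleftrightarrow> h b = h t \<otimes>\<^bsub>B\<^esub> x" if b: "b \<in> carrier A" "t \<in> S" for b t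
    proof -
      have "h t \<otimes>\<^bsub>B\<^esub> h a = h s \<otimes>\<^bsub>B\<^esub> (h t \<otimes>\<^bsub>B\<^esub> x)"
        using that \<open>x \<in> carrier B\<close> \<open>s \<in> S\<close> \<open>h a = _\<close> by (simp add: B.m_lcomm)
      then show ?thesis
        using that \<open>x \<in> carrier B\<close> \<open>s \<in> S\<close> cancel[of s "h t \<otimes>\<^bsub>B\<^esub> x" "h b"] by auto
    qed
    have "(b, t) \<in> loc_frac A S a s \<longleftrightarrow> (b, t) \<in> \<Phi> x" for b t
      unfolding loc_frac_def \<Phi>_def using that(1,2) *[of b t]
      by (cases "b \<in> carrier A \<and> t \<in> S") (simp add: rel, auto simp: rel)
    then show ?thesis
      by auto
  qed
  have nonempty: "\<Phi> x \<noteq> {}" if "x \<in> carrier B" for x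
    using denom[OF that] unfolding \<Phi>_def by blast
  have \<Phi>D: "a \<in> carrier A \<and> s \<in> S \<and> h a = h s \<otimes>\<^bsub>B\<^esub> x" if "(a, s) \<in> \<Phi> x" for a s x
    using that unfolding \<Phi>_def by auto
  have inj\<Phi>: "inj_on \<Phi> (carrier B)"
  proof (rule inj_onI)
    fix x y assume xy: "x \<in> carrier B" "y \<in> carrier B" "\<Phi> x = \<Phi> y"
    then obtain a s where "(a, s) \<in> \<Phi> x" "(a, s) \<in> \<Phi> y"
      using nonempty by fastforce
    then show "x = y"
      using xy \<Phi>D cancel by metis
  qed
  have car: "carrier L = \<Phi> ` carrier B"
  proof -
    have "\<exists>x\<in>carrier B. loc_frac A S a s = \<Phi> x" if "a \<in> carrier A" "s \<in> S" for a s
    proof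
      show "loc_frac A S a s = \<Phi> (inv\<^bsub>B\<^esub> (h s) \<otimes>\<^bsub>B\<^esub> h a)"
        by (rule frac) (use that in \<open>simp_all add: B.m_assoc[symmetric]\<close>)
    qed (use that in auto)
    moreover have "\<exists>a\<in>carrier A. \<exists>s\<in>S. \<Phi> x = loc_frac A S a s" if "x \<in> carrier B" for x
      using denom[OF that] frac that by metis
    ultimately have "(\<lambda>(a, s). loc_frac A S a s) ` (carrier A \<times> S) = \<Phi> ` carrier B"
      by fastforce
    moreover have "carrier L = (\<lambda>(a, s). loc_frac A S a s) ` (carrier A \<times> S)"
      unfolding L_def localization_def loc_frac_def quotient_def by auto
    ultimately show ?thesis by simp
  qed
  have L_mult: "\<Phi> x \<otimes>\<^bsub>L\<^esub> \<Phi> y = \<Phi> (x \<otimes>\<^bsub>B\<^esub> y)"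
    if "x \<in> carrier B" "y \<in> carrier B" for x y
    unfolding L_def localization_def monoid.simps
    by (intro UN_case_prod_eq_const nonempty that frac)
       (auto dest!: \<Phi>D simp: that B.m_ac)
  have L_add: "\<Phi> x \<oplus>\<^bsub>L\<^esub> \<Phi> y = \<Phi> (x \<oplus>\<^bsub>B\<^esub> y)"
    if "x \<in> carrier B" "y \<in> carrier B" for x y
    unfolding L_def localization_def ring.simps
    by (intro UN_case_prod_eq_const nonempty that frac)
       (auto dest!: \<Phi>D simp: that B.m_ac B.r_distr)
  have L_smult: "r \<odot>\<^bsub>L\<^esub> \<Phi> x = \<Phi> (r \<odot>\<^bsub>B\<^esub> x)"
    if "r \<in> carrier R" "x \<in> carrier B" for r x
    unfolding L_def localization_def module.simps
    by (intro UN_case_prod_eq_const nonempty that frac)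
       (auto dest!: \<Phi>D simp: that B.m_comm[of "h _"] B.smult_assoc2)
  have L_one: "\<one>\<^bsub>L\<^esub> = \<Phi> \<one>\<^bsub>B\<^esub>"
    unfolding L_def localization_def monoid.simps by (rule frac) simp_all
  have L_zero: "\<zero>\<^bsub>L\<^esub> = \<Phi> \<zero>\<^bsub>B\<^esub>"
    unfolding L_def localization_def ring.simps by (rule frac) simp_all
  define g where "g = inv_into (carrier B) \<Phi>"
  have g [simp]: "g (\<Phi> x) = x" if "x \<in> carrier B" for x
    using inj\<Phi> that unfolding g_def by simp
  note L = car L_mult L_add L_smult L_one L_zero
  show "algebra R (localization A S)"
    unfolding L_def[symmetric]
    by (rule algebra_pullback[OF B, where h = g]) (auto simp: L inj_on_def)
  have "\<Phi> \<in> algebra_iso R B L"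
    unfolding algebra_iso_def ring_iso_def
    using inj\<Phi> by (auto simp: ring_hom_def bij_betw_def L)
  then show "\<exists>\<phi>. \<phi> \<in> algebra_iso R B (localization A S)"
    unfolding L_def by blast
qed

section \<open>The algebra of functions on the positive rationals\<close>

lemma (in cring) finsum_swap:
  assumes "finite A" "finite B" "\<And>x y. x \<in> A \<Longrightarrow> y \<in> B \<Longrightarrow> f x y \<in> carrier R"
  shows "(\<Oplus>x\<in>A. \<Oplus>y\<in>B. f x y) = (\<Oplus>y\<in>B. \<Oplus>x\<in>A. f x y)"
  using assms(1,3)
proof (induction A rule: finite_induct)
  case empty
  then show ?case by simp
next
  case (insert a A)
  then have "(\<Oplus>x\<in>insert a A. \<Oplus>y\<in>B. f x y) = (\<Oplus>y\<in>B. f a y) \<oplus> (\<Oplus>y\<in>B. \<Oplus>x\<in>A. f x y)"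
    by (subst finsum_insert) (auto simp: Pi_def)
  also have "\<dots> = (\<Oplus>y\<in>B. f a y \<oplus> (\<Oplus>x\<in>A. f x y))"
    using insert by (subst finsum_addf) (auto simp: Pi_def)
  also have "\<dots> = (\<Oplus>y\<in>B. \<Oplus>x\<in>insert a A. f x y)"
    using insert by (intro finsum_cong') (auto simp: Pi_def finsum_insert)
  finally show ?case .
qed

text \<open>
  The positive rationals \<open>p \<le> c\<close> for which \<open>d * p\<close> is a positive integer; the sums that compute
  convolutions are taken over these finite sets.
\<close>

definition rat_box :: "nat \<Rightarrow> rat \<Rightarrow> rat set"
  where "rat_box d c = {p. 0 < p \<and> p \<le> c \<and> (\<exists>n::nat. 0 < n \<and> of_nat d * p = of_nat n)}"

lemma finite_rat_box:
  assumes "0 < d"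
  shows "finite (rat_box d c)"
proof (rule finite_subset)
  show "rat_box d c \<subseteq> (\<lambda>n::nat. of_nat n / of_nat d) ` {..nat \<lfloor>of_nat d * c\<rfloor>}"
  proof
    fix p assume "p \<in> rat_box d c"
    then obtain n :: nat where p: "0 < p" "p \<le> c" "of_nat d * p = of_nat n"
      unfolding rat_box_def by auto
    then have "of_nat n \<le> of_nat d * c"
      by (metis mult_left_mono of_nat_0_le_iff)
    then have "int n \<le> \<lfloor>of_nat d * c\<rfloor>"
      by (simp add: le_floor_iff)
    then have "n \<le> nat \<lfloor>of_nat d * c\<rfloor>"
      by linarith
    moreover have "p = of_nat n / of_nat d"
      using p assms by (simp add: field_simps)
    ultimately show "p \<in> (\<lambda>n::nat. of_nat n / of_nat d) ` {..nat \<lfloor>of_nat d * c\<rfloor>}"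
      by auto
  qed
qed simp

lemma rat_box_pos: "p \<in> rat_box d c \<Longrightarrow> 0 < p"
  by (simp add: rat_box_def)

text \<open>
  \<open>d\<close> is a positive common denominator of the support of \<open>\<alpha>\<close>.  Values outside the positive
  rationals are ignored, since an extensional function is \<open>undefined\<close> there.
\<close>

definition has_denom :: "('a, 'm) ring_scheme \<Rightarrow> (rat \<Rightarrow> 'a) \<Rightarrow> nat \<Rightarrow> bool"
  where "has_denom R \<alpha> d \<longleftrightarrow> 0 < d \<and>
    (\<forall>q\<in>{0<..}. \<alpha> q \<noteq> \<zero>\<^bsub>R\<^esub> \<longrightarrow> (\<exists>n::nat. 0 < n \<and> of_nat d * q = of_nat n))"

lemma has_denomE:
  assumes "has_denom R \<alpha> d" "0 < q" "\<alpha> q \<noteq> \<zero>\<^bsub>R\<^esub>"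
  obtains n :: nat where "0 < n" "of_nat d * q = of_nat n"
  using assms unfolding has_denom_def by auto

text \<open>A factor \<open>q / p\<close> in the support of \<open>\<beta>\<close> is at least \<open>1 / e\<close>, so the cofactor \<open>p\<close> is bounded.\<close>

lemma has_denom_le:
  assumes "has_denom R \<beta> e" "0 < p" "0 < q" "\<beta> (q / p) \<noteq> \<zero>\<^bsub>R\<^esub>"
  shows "p \<le> of_nat e * q"
proof -
  obtain n :: nat where "0 < n" "of_nat e * (q / p) = of_nat n"
    using has_denomE[OF assms(1), of "q / p"] assms by auto
  then have "1 \<le> of_nat e * (q / p)"
    by simp
  then show ?thesis
    using assms by (simp add: field_simps)
qed

lemma has_denom_rat_box:
  assumes "has_denom R \<alpha> d" "0 < p" "\<alpha> p \<noteq> \<zero>\<^bsub>R\<^esub>" "p \<le> c"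
  shows "p \<in> rat_box d c"
  using assms unfolding has_denom_def rat_box_def by auto

context cring
begin

abbreviation \<F> where "\<F> \<equiv> rat_fun_algebra R"

lemma carrier_\<F>: "\<alpha> \<in> carrier \<F> \<longleftrightarrow> \<alpha> \<in> {0<..} \<rightarrow>\<^sub>E carrier R \<and> (\<exists>d. has_denom R \<alpha> d)"
  by (simp add: rat_fun_algebra_def has_denom_def)

lemma \<F>_value [simp]: "\<alpha> \<in> carrier \<F> \<Longrightarrow> 0 < q \<Longrightarrow> \<alpha> q \<in> carrier R"
  by (auto simp: carrier_\<F>)

lemma \<F>_apply [simp]:
  assumes "0 < q"
  shows "(\<alpha> \<oplus>\<^bsub>\<F>\<^esub> \<beta>) q = \<alpha> q \<oplus> \<beta> q" "(r \<odot>\<^bsub>\<F>\<^esub> \<alpha>) q = r \<otimes> \<alpha> q"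
    "\<zero>\<^bsub>\<F>\<^esub> q = \<zero>" "\<one>\<^bsub>\<F>\<^esub> q = (if q = 1 then \<one> else \<zero>)"
  using assms by (simp_all add: rat_fun_algebra_def)

text \<open>
  The product as a sum over one variable, in which the index set may be any finite set that contains
  the indices of the nonzero terms.
\<close>

lemma mult_eq_finsum:
  assumes \<alpha>: "\<alpha> \<in> {0<..} \<rightarrow>\<^sub>E carrier R" and \<beta>: "\<beta> \<in> {0<..} \<rightarrow>\<^sub>E carrier R"
    and q: "0 < q" and T: "finite T" "T \<subseteq> {0<..}"
    and supp: "\<And>p. 0 < p \<Longrightarrow> \<alpha> p \<noteq> \<zero> \<Longrightarrow> \<beta> (q / p) \<noteq> \<zero> \<Longrightarrow> p \<in> T"
  shows "(\<alpha> \<otimes>\<^bsub>\<F>\<^esub> \<beta>) q = (\<Oplus>p\<in>T. \<alpha> p \<otimes> \<beta> (q / p))"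
proof -
  have car: "\<alpha> p \<in> carrier R" "\<beta> p \<in> carrier R" if "0 < p" for p
    using that \<alpha> \<beta> by auto
  define T' where "T' = {p \<in> T. \<alpha> p \<otimes> \<beta> (q / p) \<noteq> \<zero>}"
  have T': "T' \<subseteq> T" "T' \<subseteq> {0<..}"
    using T by (auto simp: T'_def)
  have pairs: "{p \<in> {0<..} \<times> {0<..}. fst p * snd p = q \<and> \<alpha> (fst p) \<otimes> \<beta> (snd p) \<noteq> \<zero>} =
      (\<lambda>p. (p, q / p)) ` T'" (is "?P = _")
  proof (intro equalityI subsetI)
    fix x assume "x \<in> ?P"
    then obtain p r where x: "x = (p, r)" "0 < p" "0 < r" "p * r = q" "\<alpha> p \<otimes> \<beta> r \<noteq> \<zero>"
      by (cases x) auto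
    have r: "r = q / p"
      using x by (simp add: field_simps)
    have "\<alpha> p \<noteq> \<zero>" "\<beta> r \<noteq> \<zero>"
      using x car by auto
    then have "p \<in> T'"
      using x supp[of p] unfolding T'_def r by auto
    then show "x \<in> (\<lambda>p. (p, q / p)) ` T'"
      using x r by auto
  next
    fix x assume "x \<in> (\<lambda>p. (p, q / p)) ` T'"
    then show "x \<in> ?P"
      using T q by (auto simp: T'_def subset_iff)
  qed
  have "(\<alpha> \<otimes>\<^bsub>\<F>\<^esub> \<beta>) q = (\<Oplus>x\<in>?P. \<alpha> (fst x) \<otimes> \<beta> (snd x))"
    using q by (simp add: rat_fun_algebra_def)
  also have "\<dots> = (\<Oplus>p\<in>T'. \<alpha> p \<otimes> \<beta> (q / p))"
    unfolding pairs using T' q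
    by (subst finsum_reindex) (auto intro!: inj_onI m_closed car)
  also have "\<dots> = (\<Oplus>p\<in>T. \<alpha> p \<otimes> \<beta> (q / p))"
    using T T' q
    by (intro add.finprod_mono_neutral_cong_left) (auto simp: T'_def intro!: m_closed car)
  finally show ?thesis .
qed

text \<open>
  A concrete index set.  The slack in the bound \<open>c\<close> allows the same set to be used for
  all the inner sums in the proof of associativity.
\<close>

lemma mult_eq_finsum_rat_box:
  assumes \<alpha>: "\<alpha> \<in> {0<..} \<rightarrow>\<^sub>E carrier R" "has_denom R \<alpha> d"
    and \<beta>: "\<beta> \<in> {0<..} \<rightarrow>\<^sub>E carrier R" "has_denom R \<beta> e"
    and "0 < q" "of_nat e * q \<le> c"
  shows "(\<alpha> \<otimes>\<^bsub>\<F>\<^esub> \<beta>) q = (\<Oplus>p\<in>rat_box d c. \<alpha> p \<otimes> \<beta> (q / p))"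
proof (rule mult_eq_finsum)
  show "finite (rat_box d c)"
    using \<alpha>(2) finite_rat_box unfolding has_denom_def by blast
  show "p \<in> rat_box d c" if "0 < p" "\<alpha> p \<noteq> \<zero>" "\<beta> (q / p) \<noteq> \<zero>" for p
    using that has_denom_le[OF \<beta>(2), of p q] assms
    by (intro has_denom_rat_box[OF \<alpha>(2)]) auto
qed (use assms rat_box_pos in auto)

lemma \<F>_mult_PiE:
  assumes "\<alpha> \<in> {0<..} \<rightarrow>\<^sub>E carrier R" "\<beta> \<in> {0<..} \<rightarrow>\<^sub>E carrier R"
  shows "\<alpha> \<otimes>\<^bsub>\<F>\<^esub> \<beta> \<in> {0<..} \<rightarrow>\<^sub>E carrier R"
  unfolding rat_fun_algebra_def using assms
  by (auto intro!: finsum_closed m_closed)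

lemma \<F>_add_PiE:
  assumes "\<alpha> \<in> {0<..} \<rightarrow>\<^sub>E carrier R" "\<beta> \<in> {0<..} \<rightarrow>\<^sub>E carrier R"
  shows "\<alpha> \<oplus>\<^bsub>\<F>\<^esub> \<beta> \<in> {0<..} \<rightarrow>\<^sub>E carrier R"
  unfolding rat_fun_algebra_def using assms by auto

lemma \<F>_smult_PiE:
  assumes "r \<in> carrier R" "\<beta> \<in> {0<..} \<rightarrow>\<^sub>E carrier R"
  shows "r \<odot>\<^bsub>\<F>\<^esub> \<beta> \<in> {0<..} \<rightarrow>\<^sub>E carrier R"
  unfolding rat_fun_algebra_def using assms by auto

lemma \<F>_mult_nonzeroE:
  assumes "\<alpha> \<in> {0<..} \<rightarrow>\<^sub>E carrier R" "\<beta> \<in> {0<..} \<rightarrow>\<^sub>E carrier R"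
    and "0 < q" "(\<alpha> \<otimes>\<^bsub>\<F>\<^esub> \<beta>) q \<noteq> \<zero>"
  obtains p where "0 < p" "\<alpha> p \<noteq> \<zero>" "\<beta> (q / p) \<noteq> \<zero>"
proof (rule ccontr)
  assume "\<not> thesis"
  with that have *: "p \<in> {}" if "0 < p" "\<alpha> p \<noteq> \<zero>" "\<beta> (q / p) \<noteq> \<zero>" for p
    using that by blast
  have "(\<alpha> \<otimes>\<^bsub>\<F>\<^esub> \<beta>) q = (\<Oplus>p\<in>{}. \<alpha> p \<otimes> \<beta> (q / p))"
    by (rule mult_eq_finsum) (use assms * in auto)
  with assms show False by simp
qed

lemma has_denom_mult:
  assumes "\<alpha> \<in> {0<..} \<rightarrow>\<^sub>E carrier R" "has_denom R \<alpha> d"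
    and "\<beta> \<in> {0<..} \<rightarrow>\<^sub>E carrier R" "has_denom R \<beta> e"
  shows "has_denom R (\<alpha> \<otimes>\<^bsub>\<F>\<^esub> \<beta>) (d * e)"
  unfolding has_denom_def
proof (intro conjI ballI impI)
  show "0 < d * e"
    using assms by (simp add: has_denom_def)
next
  fix q :: rat assume q: "q \<in> {0<..}" "(\<alpha> \<otimes>\<^bsub>\<F>\<^esub> \<beta>) q \<noteq> \<zero>"
  then obtain p where p: "0 < p" "\<alpha> p \<noteq> \<zero>" "\<beta> (q / p) \<noteq> \<zero>"
    using \<F>_mult_nonzeroE[OF assms(1,3), of q] by auto
  obtain m :: nat where m: "0 < m" "of_nat d * p = of_nat m"
    using has_denomE[OF assms(2) p(1,2)] .
  obtain n :: nat where n: "0 < n" "of_nat e * (q / p) = of_nat n"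
    using has_denomE[OF assms(4), of "q / p"] p q by auto
  have "of_nat (d * e) * q = (of_nat d * p) * (of_nat e * (q / p))"
    using p by simp
  also have "\<dots> = of_nat (m * n)"
    using m n by simp
  finally show "\<exists>k::nat. 0 < k \<and> of_nat (d * e) * q = of_nat k"
    using m n by (intro exI[of _ "m * n"]) simp
qed

lemma has_denom_dvd:
  assumes "has_denom R \<alpha> d" "d dvd e" "0 < e"
  shows "has_denom R \<alpha> e"
  unfolding has_denom_def
proof (intro conjI ballI impI)
  fix q :: rat assume "q \<in> {0<..}" "\<alpha> q \<noteq> \<zero>"
  then obtain m :: nat where m: "0 < m" "of_nat d * q = of_nat m"
    using has_denomE[OF assms(1), of q] by auto
  obtain k where k: "e = d * k"
    using assms by blast
  show "\<exists>n::nat. 0 < n \<and> of_nat e * q = of_nat n"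
    using m k assms by (intro exI[of _ "m * k"]) (simp add: mult_ac flip: m(2))
qed (use assms in simp)

lemma has_denom_add:
  assumes "has_denom R \<alpha> d" "has_denom R \<beta> d"
  shows "has_denom R (\<alpha> \<oplus>\<^bsub>\<F>\<^esub> \<beta>) d"
  unfolding has_denom_def
proof (intro conjI ballI impI)
  fix q :: rat assume q: "q \<in> {0<..}" "(\<alpha> \<oplus>\<^bsub>\<F>\<^esub> \<beta>) q \<noteq> \<zero>"
  then have "\<alpha> q \<noteq> \<zero> \<or> \<beta> q \<noteq> \<zero>" by auto
  then show "\<exists>n::nat. 0 < n \<and> of_nat d * q = of_nat n"
    using q assms unfolding has_denom_def by blast
qed (use assms in \<open>simp add: has_denom_def\<close>)

lemma has_denom_smult:
  assumes "has_denom R \<alpha> d" "r \<in> carrier R"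
  shows "has_denom R (r \<odot>\<^bsub>\<F>\<^esub> \<alpha>) d"
  using assms unfolding has_denom_def by (metis \<F>_apply(2) greaterThan_iff r_null)

lemma common_denom:
  assumes "\<alpha> \<in> carrier \<F>" "\<beta> \<in> carrier \<F>"
  obtains d where "has_denom R \<alpha> d" "has_denom R \<beta> d"
proof -
  obtain d e where "has_denom R \<alpha> d" "has_denom R \<beta> e"
    using assms by (auto simp: carrier_\<F>)
  moreover from this have "0 < d * e"
    by (simp add: has_denom_def)
  ultimately show ?thesis
    using that[of "d * e"] has_denom_dvd[of \<alpha> d "d * e"] has_denom_dvd[of \<beta> e "d * e"] by simp
qed

lemma \<F>_closed:
  shows "\<alpha> \<in> carrier \<F> \<Longrightarrow> \<beta> \<in> carrier \<F> \<Longrightarrow> \<alpha> \<otimes>\<^bsub>\<F>\<^esub> \<beta> \<in> carrier \<F>"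
    and "\<alpha> \<in> carrier \<F> \<Longrightarrow> \<beta> \<in> carrier \<F> \<Longrightarrow> \<alpha> \<oplus>\<^bsub>\<F>\<^esub> \<beta> \<in> carrier \<F>"
    and "r \<in> carrier R \<Longrightarrow> \<alpha> \<in> carrier \<F> \<Longrightarrow> r \<odot>\<^bsub>\<F>\<^esub> \<alpha> \<in> carrier \<F>"
    and "\<zero>\<^bsub>\<F>\<^esub> \<in> carrier \<F>"
proof -
  show "\<alpha> \<otimes>\<^bsub>\<F>\<^esub> \<beta> \<in> carrier \<F>" if "\<alpha> \<in> carrier \<F>" "\<beta> \<in> carrier \<F>"
  proof -
    from that obtain d e where "has_denom R \<alpha> d" "has_denom R \<beta> e"
      by (auto simp: carrier_\<F>)
    with that show ?thesis
      using \<F>_mult_PiE[of \<alpha> \<beta>] has_denom_mult[of \<alpha> d \<beta> e] unfolding carrier_\<F> by blast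
  qed
  show "\<alpha> \<oplus>\<^bsub>\<F>\<^esub> \<beta> \<in> carrier \<F>" if "\<alpha> \<in> carrier \<F>" "\<beta> \<in> carrier \<F>"
  proof -
    from that obtain d where "has_denom R \<alpha> d" "has_denom R \<beta> d"
      by (rule common_denom)
    with that show ?thesis
      using \<F>_add_PiE[of \<alpha> \<beta>] has_denom_add[of \<alpha> d \<beta>] unfolding carrier_\<F> by blast
  qed
  show "r \<odot>\<^bsub>\<F>\<^esub> \<alpha> \<in> carrier \<F>" if "r \<in> carrier R" "\<alpha> \<in> carrier \<F>"
  proof -
    from that obtain d where "has_denom R \<alpha> d"
      by (auto simp: carrier_\<F>)
    with that show ?thesis
      using \<F>_smult_PiE[of r \<alpha>] has_denom_smult[of \<alpha> d r] unfolding carrier_\<F> by blast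
  qed
  have "has_denom R \<zero>\<^bsub>\<F>\<^esub> 1"
    by (simp add: has_denom_def)
  then show "\<zero>\<^bsub>\<F>\<^esub> \<in> carrier \<F>"
    unfolding carrier_\<F> by (auto simp: rat_fun_algebra_def)
qed

lemma \<F>_ext:
  assumes "\<alpha> \<in> carrier \<F>" "\<beta> \<in> carrier \<F>" "\<And>q. 0 < q \<Longrightarrow> \<alpha> q = \<beta> q"
  shows "\<alpha> = \<beta>"
  using assms by (intro PiE_ext[of \<alpha> "{0<..}" "\<lambda>_. carrier R" \<beta>]) (auto simp: carrier_\<F>)

text \<open>
  The characteristic function of \<open>{a}\<close>, for \<open>a > 0\<close>; convolution multiplies the points
  \<open>a\<close>, so these functions represent the group of positive rationals in \<open>\<F>\<close>.
\<close>

definition delta :: "rat \<Rightarrow> rat \<Rightarrow> 'a"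
  where "delta a = (\<lambda>q\<in>{0<..}. if q = a then \<one> else \<zero>)"

lemma delta_1: "delta 1 = \<one>\<^bsub>\<F>\<^esub>"
  by (simp add: delta_def rat_fun_algebra_def)

lemma delta_closed:
  assumes "0 < a"
  shows "delta a \<in> carrier \<F>"
proof -
  obtain m n where "quotient_of a = (m, n)" by (cases "quotient_of a")
  then have n: "0 < n" "a = of_int m / of_int n"
    by (simp_all add: quotient_of_denom_pos quotient_of_div)
  with assms have m: "0 < m"
    by (simp add: zero_less_divide_iff)
  have "has_denom R (delta a) (nat n)"
    unfolding has_denom_def using m n
    by (auto simp: delta_def intro!: exI[of _ "nat m"])
  then show ?thesis
    unfolding carrier_\<F> by (auto simp: delta_def)
qed

lemma delta_mult:
  assumes "0 < a" "\<alpha> \<in> carrier \<F>" "0 < q"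
  shows "(delta a \<otimes>\<^bsub>\<F>\<^esub> \<alpha>) q = \<alpha> (q / a)"
proof -
  have "(delta a \<otimes>\<^bsub>\<F>\<^esub> \<alpha>) q = (\<Oplus>p\<in>{a}. delta a p \<otimes> \<alpha> (q / p))"
    by (rule mult_eq_finsum)
       (use assms delta_closed in \<open>auto simp: carrier_\<F> delta_def split: if_splits\<close>)
  also have "\<dots> = \<alpha> (q / a)"
    using assms by (simp add: delta_def)
  finally show ?thesis .
qed

lemma delta_mult_delta:
  assumes "0 < a" "0 < b"
  shows "delta a \<otimes>\<^bsub>\<F>\<^esub> delta b = delta (a * b)"
proof (rule \<F>_ext)
  show "(delta a \<otimes>\<^bsub>\<F>\<^esub> delta b) q = delta (a * b) q" if "0 < q" for q
    unfolding delta_mult[OF assms(1) delta_closed[OF assms(2)] that]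
    using assms that by (auto simp: delta_def field_simps)
qed (use assms in \<open>simp_all add: \<F>_closed delta_closed\<close>)

lemma \<F>_mult_comm:
  assumes "\<alpha> \<in> carrier \<F>" "\<beta> \<in> carrier \<F>"
  shows "\<alpha> \<otimes>\<^bsub>\<F>\<^esub> \<beta> = \<beta> \<otimes>\<^bsub>\<F>\<^esub> \<alpha>"
proof (rule \<F>_ext)
  fix q :: rat assume q: "0 < q"
  obtain d where d: "has_denom R \<alpha> d" "has_denom R \<beta> d"
    using common_denom assms by blast
  define T where "T = rat_box d (of_nat d * q)"
  have T: "finite T" "T \<subseteq> {0<..}"
    using d finite_rat_box rat_box_pos by (auto simp: T_def has_denom_def)
  have "(\<alpha> \<otimes>\<^bsub>\<F>\<^esub> \<beta>) q = (\<Oplus>p\<in>T. \<alpha> p \<otimes> \<beta> (q / p))"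
    unfolding T_def by (rule mult_eq_finsum_rat_box) (use assms d q in \<open>auto simp: carrier_\<F>\<close>)
  also have "\<dots> = (\<Oplus>p\<in>T. \<beta> (q / p) \<otimes> \<alpha> (q / (q / p)))"
    using T q assms by (intro finsum_cong') (auto simp: m_comm)
  also have "\<dots> = (\<Oplus>p\<in>(\<lambda>p. q / p) ` T. \<beta> p \<otimes> \<alpha> (q / p))"
    using T q assms by (subst finsum_reindex) (auto intro!: inj_onI simp: field_simps)
  also have "\<dots> = (\<beta> \<otimes>\<^bsub>\<F>\<^esub> \<alpha>) q"
  proof (rule mult_eq_finsum[symmetric])
    fix p assume p: "0 < p" "\<beta> p \<noteq> \<zero>" "\<alpha> (q / p) \<noteq> \<zero>"
    have "q / p \<le> of_nat d * q"
      by (rule has_denom_le[OF d(2)]) (use p q in auto)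
    then have "q / p \<in> T"
      unfolding T_def using p q by (intro has_denom_rat_box[OF d(1)]) auto
    then show "p \<in> (\<lambda>p. q / p) ` T"
      using p q by (intro image_eqI[of _ _ "q / p"]) auto
  qed (use T q assms in \<open>auto simp: carrier_\<F>\<close>)
  finally show "(\<alpha> \<otimes>\<^bsub>\<F>\<^esub> \<beta>) q = (\<beta> \<otimes>\<^bsub>\<F>\<^esub> \<alpha>) q" .
qed (use assms \<F>_closed in auto)

lemma \<F>_mult_assoc:
  assumes "\<alpha> \<in> carrier \<F>" "\<beta> \<in> carrier \<F>" "\<gamma> \<in> carrier \<F>"
  shows "\<alpha> \<otimes>\<^bsub>\<F>\<^esub> \<beta> \<otimes>\<^bsub>\<F>\<^esub> \<gamma> = \<alpha> \<otimes>\<^bsub>\<F>\<^esub> (\<beta> \<otimes>\<^bsub>\<F>\<^esub> \<gamma>)"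
proof (rule \<F>_ext)
  fix q :: rat assume q: "0 < q"
  obtain d e f where d: "has_denom R \<alpha> d" "has_denom R \<beta> e" "has_denom R \<gamma> f"
    using assms by (auto simp: carrier_\<F>)
  have E: "\<alpha> \<in> {0<..} \<rightarrow>\<^sub>E carrier R" "\<beta> \<in> {0<..} \<rightarrow>\<^sub>E carrier R" "\<gamma> \<in> {0<..} \<rightarrow>\<^sub>E carrier R"
    using assms by (auto simp: carrier_\<F>)
  note [simp] = assms
  \<comment> \<open>\<open>T\<close> indexes the factor taken from \<open>\<alpha>\<close>, and \<open>U\<close> the product \<open>s\<close> of the factors taken from
    \<open>\<alpha>\<close> and \<open>\<beta>\<close>.\<close>
  define T where "T = rat_box d (of_nat (e * f) * q)"
  define U where "U = rat_box (d * e) (of_nat f * q)"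
  have T: "finite T" "\<And>p. p \<in> T \<Longrightarrow> 0 < p" and U: "finite U" "\<And>s. s \<in> U \<Longrightarrow> 0 < s"
    using d finite_rat_box rat_box_pos by (auto simp: T_def U_def has_denom_def)
  have "(\<alpha> \<otimes>\<^bsub>\<F>\<^esub> \<beta> \<otimes>\<^bsub>\<F>\<^esub> \<gamma>) q = (\<Oplus>s\<in>U. (\<alpha> \<otimes>\<^bsub>\<F>\<^esub> \<beta>) s \<otimes> \<gamma> (q / s))"
    unfolding U_def
    by (rule mult_eq_finsum_rat_box) (use d q E \<F>_mult_PiE has_denom_mult in auto)
  also have "\<dots> = (\<Oplus>s\<in>U. (\<Oplus>p\<in>T. \<alpha> p \<otimes> \<beta> (s / p)) \<otimes> \<gamma> (q / s))"
  proof (rule finsum_cong')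
    fix s assume s: "s \<in> U"
    then have "s \<le> of_nat f * q"
      by (simp add: U_def rat_box_def)
    then have "of_nat e * s \<le> of_nat (e * f) * q"
      by (simp add: mult.assoc mult_left_mono)
    then have "(\<alpha> \<otimes>\<^bsub>\<F>\<^esub> \<beta>) s = (\<Oplus>p\<in>T. \<alpha> p \<otimes> \<beta> (s / p))"
      unfolding T_def using s U d E by (intro mult_eq_finsum_rat_box) auto
    then show "(\<alpha> \<otimes>\<^bsub>\<F>\<^esub> \<beta>) s \<otimes> \<gamma> (q / s) = (\<Oplus>p\<in>T. \<alpha> p \<otimes> \<beta> (s / p)) \<otimes> \<gamma> (q / s)"
      by simp
  qed (use T U q in \<open>auto intro!: finsum_closed m_closed\<close>)
  also have "\<dots> = (\<Oplus>s\<in>U. \<Oplus>p\<in>T. \<alpha> p \<otimes> (\<beta> (s / p) \<otimes> \<gamma> (q / s)))"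
    using T U q
    by (intro finsum_cong') (auto simp: finsum_ldistr m_assoc intro!: finsum_closed finsum_cong')
  also have "\<dots> = (\<Oplus>p\<in>T. \<Oplus>s\<in>U. \<alpha> p \<otimes> (\<beta> (s / p) \<otimes> \<gamma> (q / s)))"
    using T U q by (intro finsum_swap) auto
  \<comment> \<open>For fixed \<open>p\<close> substitute \<open>s = p * r\<close>.  If \<open>\<alpha> p = \<zero>\<close>, then \<open>U\<close> may miss terms of the inner sum,
    but the factor \<open>\<alpha> p\<close> removes them.\<close>
  also have "\<dots> = (\<Oplus>p\<in>T. \<alpha> p \<otimes> (\<beta> \<otimes>\<^bsub>\<F>\<^esub> \<gamma>) (q / p))"
  proof (rule finsum_cong')
    fix p assume p: "p \<in> T"
    have "(\<Oplus>s\<in>U. \<beta> (s / p) \<otimes> \<gamma> (q / s)) = (\<beta> \<otimes>\<^bsub>\<F>\<^esub> \<gamma>) (q / p)" if \<alpha>p: "\<alpha> p \<noteq> \<zero>"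
    proof -
      have "(\<Oplus>s\<in>U. \<beta> (s / p) \<otimes> \<gamma> (q / s)) = (\<Oplus>s\<in>U. \<beta> (s / p) \<otimes> \<gamma> (q / p / (s / p)))"
        using T(2)[OF p] by simp
      also have "\<dots> = (\<Oplus>r\<in>(\<lambda>s. s / p) ` U. \<beta> r \<otimes> \<gamma> (q / p / r))"
        using T(2)[OF p] U q by (subst finsum_reindex) (auto intro!: inj_onI)
      also have "\<dots> = (\<beta> \<otimes>\<^bsub>\<F>\<^esub> \<gamma>) (q / p)"
      proof (rule mult_eq_finsum[symmetric])
        fix r assume r: "0 < r" "\<beta> r \<noteq> \<zero>" "\<gamma> (q / p / r) \<noteq> \<zero>"
        have p0: "0 < p" using T p by blast
        obtain m :: nat where m: "0 < m" "of_nat d * p = of_nat m"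
          using has_denomE[OF d(1) p0 \<alpha>p] .
        obtain n :: nat where n: "0 < n" "of_nat e * r = of_nat n"
          using has_denomE[OF d(2) r(1,2)] .
        have "of_nat (d * e) * (p * r) = (of_nat d * p) * (of_nat e * r)"
          by simp
        also have "\<dots> = of_nat (m * n)"
          using m n by simp
        finally have "of_nat (d * e) * (p * r) = of_nat (m * n)" .
        moreover have "p * r \<le> of_nat f * q"
          by (rule has_denom_le[OF d(3)]) (use p0 r q in \<open>auto simp: field_simps\<close>)
        ultimately have "p * r \<in> U"
          unfolding U_def rat_box_def using p0 r m n by (auto intro!: exI[of _ "m * n"])
        then show "r \<in> (\<lambda>s. s / p) ` U"
          using p0 by (intro image_eqI[of _ _ "p * r"]) auto
      qed (use T p U q E in auto)
      finally show ?thesis .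
    qed
    moreover have "(\<Oplus>s\<in>U. \<alpha> p \<otimes> (\<beta> (s / p) \<otimes> \<gamma> (q / s))) = \<alpha> p \<otimes> (\<Oplus>s\<in>U. \<beta> (s / p) \<otimes> \<gamma> (q / s))"
      using T p U q by (intro finsum_rdistr[symmetric]) auto
    moreover have "(\<Oplus>s\<in>U. \<beta> (s / p) \<otimes> \<gamma> (q / s)) \<in> carrier R"
      using T p U q by (intro finsum_closed) auto
    moreover have "(\<beta> \<otimes>\<^bsub>\<F>\<^esub> \<gamma>) (q / p) \<in> carrier R"
      using T p q \<F>_closed by simp
    ultimately show "(\<Oplus>s\<in>U. \<alpha> p \<otimes> (\<beta> (s / p) \<otimes> \<gamma> (q / s))) = \<alpha> p \<otimes> (\<beta> \<otimes>\<^bsub>\<F>\<^esub> \<gamma>) (q / p)"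
      by (cases "\<alpha> p = \<zero>") auto
  qed (use T q \<F>_closed in auto)
  also have "\<dots> = (\<alpha> \<otimes>\<^bsub>\<F>\<^esub> (\<beta> \<otimes>\<^bsub>\<F>\<^esub> \<gamma>)) q"
    unfolding T_def
    by (rule mult_eq_finsum_rat_box[symmetric])
       (use d q E \<F>_mult_PiE has_denom_mult[of \<beta> e \<gamma> f] in auto)
  finally show "(\<alpha> \<otimes>\<^bsub>\<F>\<^esub> \<beta> \<otimes>\<^bsub>\<F>\<^esub> \<gamma>) q = (\<alpha> \<otimes>\<^bsub>\<F>\<^esub> (\<beta> \<otimes>\<^bsub>\<F>\<^esub> \<gamma>)) q" .
qed (use assms \<F>_closed in auto)

lemma \<F>_distr:
  assumes "\<alpha> \<in> carrier \<F>" "\<beta> \<in> carrier \<F>" "\<gamma> \<in> carrier \<F>"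
  shows "(\<alpha> \<oplus>\<^bsub>\<F>\<^esub> \<beta>) \<otimes>\<^bsub>\<F>\<^esub> \<gamma> = \<alpha> \<otimes>\<^bsub>\<F>\<^esub> \<gamma> \<oplus>\<^bsub>\<F>\<^esub> \<beta> \<otimes>\<^bsub>\<F>\<^esub> \<gamma>"
proof (rule \<F>_ext)
  fix q :: rat assume q: "0 < q"
  obtain d where "has_denom R \<alpha> d" "has_denom R \<beta> d"
    using common_denom[OF assms(1,2)] .
  moreover obtain e where "has_denom R \<gamma> e"
    using assms(3) by (auto simp: carrier_\<F>)
  ultimately have d: "has_denom R \<alpha> d" "has_denom R \<beta> d" "has_denom R \<gamma> e"
    by simp_all
  define T where "T = rat_box d (of_nat e * q)"
  have T: "finite T" "\<And>p. p \<in> T \<Longrightarrow> 0 < p"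
    using d finite_rat_box rat_box_pos by (auto simp: T_def has_denom_def)
  have eq: "(\<eta> \<otimes>\<^bsub>\<F>\<^esub> \<gamma>) q = (\<Oplus>p\<in>T. \<eta> p \<otimes> \<gamma> (q / p))"
    if "\<eta> \<in> carrier \<F>" "has_denom R \<eta> d" for \<eta>
    unfolding T_def
    by (rule mult_eq_finsum_rat_box) (use that d q assms in \<open>auto simp: carrier_\<F>\<close>)
  have "((\<alpha> \<oplus>\<^bsub>\<F>\<^esub> \<beta>) \<otimes>\<^bsub>\<F>\<^esub> \<gamma>) q = (\<Oplus>p\<in>T. (\<alpha> p \<otimes> \<gamma> (q / p)) \<oplus> (\<beta> p \<otimes> \<gamma> (q / p)))"
    using assms d T q
    by (subst eq) (auto intro!: \<F>_closed has_denom_add finsum_cong' simp: l_distr simp del: finsum_addf)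
  also have "\<dots> = (\<alpha> \<otimes>\<^bsub>\<F>\<^esub> \<gamma> \<oplus>\<^bsub>\<F>\<^esub> \<beta> \<otimes>\<^bsub>\<F>\<^esub> \<gamma>) q"
    using assms d T q by (subst finsum_addf) (auto simp: eq)
  finally show "((\<alpha> \<oplus>\<^bsub>\<F>\<^esub> \<beta>) \<otimes>\<^bsub>\<F>\<^esub> \<gamma>) q = (\<alpha> \<otimes>\<^bsub>\<F>\<^esub> \<gamma> \<oplus>\<^bsub>\<F>\<^esub> \<beta> \<otimes>\<^bsub>\<F>\<^esub> \<gamma>) q" .
qed (use assms \<F>_closed in auto)

lemma \<F>_smult_mult:
  assumes "r \<in> carrier R" "\<alpha> \<in> carrier \<F>" "\<beta> \<in> carrier \<F>"
  shows "(r \<odot>\<^bsub>\<F>\<^esub> \<alpha>) \<otimes>\<^bsub>\<F>\<^esub> \<beta> = r \<odot>\<^bsub>\<F>\<^esub> (\<alpha> \<otimes>\<^bsub>\<F>\<^esub> \<beta>)"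
proof (rule \<F>_ext)
  fix q :: rat assume q: "0 < q"
  obtain d e where d: "has_denom R \<alpha> d" "has_denom R \<beta> e"
    using assms by (auto simp: carrier_\<F>)
  define T where "T = rat_box d (of_nat e * q)"
  have T: "finite T" "\<And>p. p \<in> T \<Longrightarrow> 0 < p"
    using d finite_rat_box rat_box_pos by (auto simp: T_def has_denom_def)
  have eq: "(\<eta> \<otimes>\<^bsub>\<F>\<^esub> \<beta>) q = (\<Oplus>p\<in>T. \<eta> p \<otimes> \<beta> (q / p))"
    if "\<eta> \<in> carrier \<F>" "has_denom R \<eta> d" for \<eta>
    unfolding T_def
    by (rule mult_eq_finsum_rat_box) (use that d q assms in \<open>auto simp: carrier_\<F>\<close>)
  have "((r \<odot>\<^bsub>\<F>\<^esub> \<alpha>) \<otimes>\<^bsub>\<F>\<^esub> \<beta>) q = (\<Oplus>p\<in>T. r \<otimes> (\<alpha> p \<otimes> \<beta> (q / p)))"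
    using assms d T q
    by (subst eq) (auto intro!: \<F>_closed has_denom_smult finsum_cong' simp: m_assoc)
  also have "\<dots> = (r \<odot>\<^bsub>\<F>\<^esub> (\<alpha> \<otimes>\<^bsub>\<F>\<^esub> \<beta>)) q"
    using assms d T q by (simp add: eq finsum_rdistr)
  finally show "((r \<odot>\<^bsub>\<F>\<^esub> \<alpha>) \<otimes>\<^bsub>\<F>\<^esub> \<beta>) q = (r \<odot>\<^bsub>\<F>\<^esub> (\<alpha> \<otimes>\<^bsub>\<F>\<^esub> \<beta>)) q" .
qed (use assms \<F>_closed in auto)

lemma algebra_\<F>: "algebra R \<F>"
proof (rule algebraI)
  show "cring \<F>"
  proof (rule cringI)
    show "abelian_group \<F>"
    proof (rule abelian_groupI)
      fix \<alpha> assume \<alpha>: "\<alpha> \<in> carrier \<F>"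
      have "(\<ominus> \<one>) \<odot>\<^bsub>\<F>\<^esub> \<alpha> \<oplus>\<^bsub>\<F>\<^esub> \<alpha> = \<zero>\<^bsub>\<F>\<^esub>"
        by (rule \<F>_ext) (use \<alpha> in \<open>auto intro!: \<F>_closed simp: l_minus l_neg\<close>)
      then show "\<exists>\<beta>\<in>carrier \<F>. \<beta> \<oplus>\<^bsub>\<F>\<^esub> \<alpha> = \<zero>\<^bsub>\<F>\<^esub>"
        using \<alpha> \<F>_closed(3)[of "\<ominus> \<one>" \<alpha>] by auto
    qed (auto intro!: \<F>_ext \<F>_closed simp: a_ac)
    show "Group.comm_monoid \<F>"
    proof (rule comm_monoidI)
      show "\<one>\<^bsub>\<F>\<^esub> \<otimes>\<^bsub>\<F>\<^esub> \<alpha> = \<alpha>" if "\<alpha> \<in> carrier \<F>" for \<alpha>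
        using that delta_closed[of 1] unfolding delta_1[symmetric]
        by (intro \<F>_ext) (auto intro: \<F>_closed simp: delta_mult)
    qed (use delta_closed[of 1] in \<open>auto simp: \<F>_closed \<F>_mult_assoc delta_1 intro: \<F>_mult_comm\<close>)
  qed (rule \<F>_distr)
next
  fix r s \<alpha> assume *: "r \<in> carrier R" "s \<in> carrier R" "\<alpha> \<in> carrier \<F>"
  show "(r \<oplus> s) \<odot>\<^bsub>\<F>\<^esub> \<alpha> = r \<odot>\<^bsub>\<F>\<^esub> \<alpha> \<oplus>\<^bsub>\<F>\<^esub> s \<odot>\<^bsub>\<F>\<^esub> \<alpha>"
    by (rule \<F>_ext) (use * in \<open>simp_all add: \<F>_closed l_distr\<close>)
  show "(r \<otimes> s) \<odot>\<^bsub>\<F>\<^esub> \<alpha> = r \<odot>\<^bsub>\<F>\<^esub> (s \<odot>\<^bsub>\<F>\<^esub> \<alpha>)"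
    by (rule \<F>_ext) (use * in \<open>simp_all add: \<F>_closed m_assoc\<close>)
next
  fix r \<alpha> \<beta> assume *: "r \<in> carrier R" "\<alpha> \<in> carrier \<F>" "\<beta> \<in> carrier \<F>"
  show "r \<odot>\<^bsub>\<F>\<^esub> (\<alpha> \<oplus>\<^bsub>\<F>\<^esub> \<beta>) = r \<odot>\<^bsub>\<F>\<^esub> \<alpha> \<oplus>\<^bsub>\<F>\<^esub> r \<odot>\<^bsub>\<F>\<^esub> \<beta>"
    by (rule \<F>_ext) (use * in \<open>simp_all add: \<F>_closed r_distr\<close>)
next
  fix \<alpha> assume *: "\<alpha> \<in> carrier \<F>"
  show "\<one> \<odot>\<^bsub>\<F>\<^esub> \<alpha> = \<alpha>"
    by (rule \<F>_ext) (use * in \<open>simp_all add: \<F>_closed\<close>)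
qed (simp_all add: is_cring \<F>_closed \<F>_smult_mult)

end

section \<open>Monomials as positive integers\<close>

text \<open>The primes in increasing order, from \<open>nth_prime 0 = 2\<close> on.\<close>

definition nth_prime :: "nat \<Rightarrow> nat"
  where "nth_prime = enumerate {p. prime p}"

lemma nth_prime: "bij_betw nth_prime UNIV {p. prime p}"
  unfolding nth_prime_def using primes_infinite by (rule bij_enumerate)

text \<open>The integer obtained from the monomial with exponent vector \<open>m\<close> when the variables are replaced
  by the primes.\<close>

definition prime_val :: "(nat \<Rightarrow>\<^sub>0 nat) \<Rightarrow> nat"
  where "prime_val m = (\<Prod>i\<in>Poly_Mapping.keys m. nth_prime i ^ Poly_Mapping.lookup m i)"

lemma prime_nth_prime [simp]: "prime (nth_prime i)"
  using nth_prime by (auto simp: bij_betw_def)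

lemma nth_prime_eq_iff [simp]: "nth_prime i = nth_prime j \<longleftrightarrow> i = j"
  using nth_prime by (auto simp: bij_betw_def inj_eq)

lemma prime_val_eq:
  assumes "finite T" "Poly_Mapping.keys m \<subseteq> T"
  shows "prime_val m = (\<Prod>i\<in>T. nth_prime i ^ Poly_Mapping.lookup m i)"
  unfolding prime_val_def
  by (rule prod.mono_neutral_left) (use assms in \<open>auto simp: in_keys_iff\<close>)

lemma prime_val_pos [simp]: "0 < prime_val m"
  unfolding prime_val_def by (intro prod_pos) (simp add: prime_gt_0_nat)

lemma prime_val_add: "prime_val (m + n) = prime_val m * prime_val n"
proof -
  let ?T = "Poly_Mapping.keys m \<union> Poly_Mapping.keys n"
  have "prime_val (m + n) = (\<Prod>i\<in>?T. nth_prime i ^ Poly_Mapping.lookup (m + n) i)"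
    by (rule prime_val_eq) (auto dest: subsetD[OF Poly_Mapping.keys_add])
  also have "\<dots> = (\<Prod>i\<in>?T. nth_prime i ^ Poly_Mapping.lookup m i) *
      (\<Prod>i\<in>?T. nth_prime i ^ Poly_Mapping.lookup n i)"
    by (simp add: lookup_add power_add prod.distrib)
  also have "\<dots> = prime_val m * prime_val n"
    using prime_val_eq[of ?T m] prime_val_eq[of ?T n] by simp
  finally show ?thesis .
qed

lemma prime_val_0 [simp]: "prime_val 0 = 1"
  by (simp add: prime_val_def)

lemma multiplicity_prime_val: "multiplicity (nth_prime i) (prime_val m) = Poly_Mapping.lookup m i"
proof -
  define f where "f = Poly_Mapping.lookup m \<circ> inv_into UNIV nth_prime"
  have inj: "inj nth_prime"
    by (simp add: inj_def)
  then have "prime_val m = (\<Prod>p\<in>nth_prime ` Poly_Mapping.keys m. p ^ f p)"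
    unfolding prime_val_def by (subst prod.reindex) (auto simp: f_def inj_on_def)
  then have "multiplicity (nth_prime i) (prime_val m) =
      (if nth_prime i \<in> nth_prime ` Poly_Mapping.keys m then f (nth_prime i) else 0)"
    by (simp only:) (subst multiplicity_prod_prime_powers, auto)
  then show ?thesis
    using inj by (auto simp: f_def in_keys_iff inj_image_mem_iff split: if_splits)
qed

lemma inj_prime_val: "inj prime_val"
  by (intro injI poly_mapping_eqI) (metis multiplicity_prime_val)

lemma prime_val_eq_iff [simp]: "prime_val m = prime_val n \<longleftrightarrow> m = n"
  using inj_prime_val by (simp add: inj_eq)

lemma prime_val_surj:
  assumes "0 < n"
  obtains m where "prime_val m = n"
proof -
  have "{i. multiplicity (nth_prime i) n \<noteq> 0} \<subseteq> nth_prime -` prime_factors n"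
    using assms by (auto simp: prime_factors_multiplicity)
  moreover have "finite (nth_prime -` prime_factors n)"
    by (rule finite_vimageI) (auto simp: inj_def)
  ultimately have fin: "finite {i. multiplicity (nth_prime i) n \<noteq> 0}"
    by (rule finite_subset)
  define m where "m = Abs_poly_mapping (\<lambda>i. multiplicity (nth_prime i) n)"
  have m: "Poly_Mapping.lookup m i = multiplicity (nth_prime i) n" for i
    using fin by (simp add: m_def Abs_poly_mapping_inverse)
  have "prime_val m = n"
  proof (rule multiplicity_eq_nat)
    fix p :: nat assume "prime p"
    then obtain i where "p = nth_prime i"
      using nth_prime by (auto simp: bij_betw_def)
    then show "multiplicity p (prime_val m) = multiplicity p n"
      by (simp add: multiplicity_prime_val m)
  qed (use assms in auto)
  then show ?thesis by (rule that)
qed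

text \<open>
  A monomial has finitely many factorizations, so the coefficients of a product of power series are
  genuine finite sums.
\<close>

lemma finite_pairs_sum_eq: "finite {p. fst p + snd p = (m :: nat \<Rightarrow>\<^sub>0 nat)}"
proof (rule finite_imageD)
  let ?f = "map_prod prime_val prime_val"
  have "?f ` {p. fst p + snd p = m} \<subseteq> {..prime_val m} \<times> {..prime_val m}"
    by (auto simp: prime_val_add Suc_le_eq)
  then show "finite (?f ` {p. fst p + snd p = m})"
    by (rule finite_subset) simp
  show "inj_on ?f {p. fst p + snd p = m}"
    by (auto simp: inj_on_def)
qed

section \<open>Power series as functions on the positive integers\<close>

context cring
begin

abbreviation \<P> where "\<P> \<equiv> powser_algebra R"

text \<open>
  A power series as a function on the positive rationals: the coefficient of the monomial \<open>m\<close>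
  becomes the value at \<open>prime_val m\<close>, and the value at a non-integer is zero.
\<close>

definition embed :: "((nat \<Rightarrow>\<^sub>0 nat) \<Rightarrow> 'a) \<Rightarrow> rat \<Rightarrow> 'a"
  where "embed f = (\<lambda>q\<in>{0<..}.
    if q \<in> range (\<lambda>m. of_nat (prime_val m))
    then f (inv_into UNIV (\<lambda>m. of_nat (prime_val m)) q) else \<zero>)"

lemma inj_of_nat_prime_val: "inj (\<lambda>m. of_nat (prime_val m) :: rat)"
  by (auto simp: inj_def)

lemma embed_prime_val [simp]: "embed f (of_nat (prime_val m)) = f m"
  using inv_into_f_f[OF inj_of_nat_prime_val, of m] by (simp add: embed_def)

lemma embed_nonzeroE:
  assumes "0 < q" "embed f q \<noteq> \<zero>"
  obtains m where "q = of_nat (prime_val m)"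
  using assms by (auto simp: embed_def split: if_splits)

lemma embed_closed: "f \<in> carrier \<P> \<Longrightarrow> embed f \<in> carrier \<F>"
proof -
  assume f: "f \<in> carrier \<P>"
  have "has_denom R (embed f) 1"
    unfolding has_denom_def
    by (metis embed_nonzeroE greaterThan_iff mult_1 of_nat_1 prime_val_pos zero_less_one)
  then show ?thesis
    using f unfolding carrier_\<F> by (auto simp: embed_def powser_algebra_def)
qed

lemma embed_eqI:
  assumes "f \<in> carrier \<P>" "\<alpha> \<in> carrier \<F>"
    and "\<And>m. \<alpha> (of_nat (prime_val m)) = f m"
    and "\<And>q. 0 < q \<Longrightarrow> \<alpha> q \<noteq> \<zero> \<Longrightarrow> \<exists>m. q = of_nat (prime_val m)"
  shows "embed f = \<alpha>"
proof (rule \<F>_ext)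
  show "embed f q = \<alpha> q" if "0 < q" for q
  proof (cases "\<exists>m. q = of_nat (prime_val m)")
    case True
    then show ?thesis using assms(3) by auto
  next
    case False
    then have "\<alpha> q = \<zero>" using assms(4) that by blast
    moreover have "embed f q = \<zero>" using False that embed_nonzeroE by blast
    ultimately show ?thesis by simp
  qed
qed (use assms(1,2) embed_closed in simp_all)

lemma inj_embed: "inj embed"
  by (intro injI ext) (metis embed_prime_val)

lemma embed_delta: "embed (\<lambda>m. if m = n then \<one> else \<zero>) = delta (of_nat (prime_val n))"
proof (rule embed_eqI)
  fix q :: rat assume "0 < q" "delta (of_nat (prime_val n)) q \<noteq> \<zero>"
  then show "\<exists>m. q = of_nat (prime_val m)"
    by (auto simp: delta_def split: if_splits)
next
  show "(\<lambda>m. if m = n then \<one> else \<zero>) \<in> carrier \<P>"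
    by (simp add: powser_algebra_def)
next
  show "delta (of_nat (prime_val n)) (of_nat (prime_val m)) = (if m = n then \<one> else \<zero>)" for m
    by (simp add: delta_def)
qed (simp add: delta_closed)

lemma \<P>_closed:
  shows "\<one>\<^bsub>\<P>\<^esub> \<in> carrier \<P>" "\<zero>\<^bsub>\<P>\<^esub> \<in> carrier \<P>"
    and "f \<in> carrier \<P> \<Longrightarrow> g \<in> carrier \<P> \<Longrightarrow> f \<oplus>\<^bsub>\<P>\<^esub> g \<in> carrier \<P>"
    and "f \<in> carrier \<P> \<Longrightarrow> g \<in> carrier \<P> \<Longrightarrow> f \<otimes>\<^bsub>\<P>\<^esub> g \<in> carrier \<P>"
    and "r \<in> carrier R \<Longrightarrow> f \<in> carrier \<P> \<Longrightarrow> r \<odot>\<^bsub>\<P>\<^esub> f \<in> carrier \<P>"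
  by (simp_all add: powser_algebra_def Pi_def finsum_closed)

lemma embed_one: "embed \<one>\<^bsub>\<P>\<^esub> = \<one>\<^bsub>\<F>\<^esub>"
  using embed_delta[of 0] by (simp add: delta_1 powser_algebra_def)

lemma embed_zero: "embed \<zero>\<^bsub>\<P>\<^esub> = \<zero>\<^bsub>\<F>\<^esub>"
proof (rule embed_eqI)
  show "\<zero>\<^bsub>\<F>\<^esub> (of_nat (prime_val m)) = \<zero>\<^bsub>\<P>\<^esub> m" for m
    by (simp, simp add: powser_algebra_def)
qed (simp_all add: \<P>_closed \<F>_closed)

lemma embed_add:
  assumes "f \<in> carrier \<P>" "g \<in> carrier \<P>"
  shows "embed (f \<oplus>\<^bsub>\<P>\<^esub> g) = embed f \<oplus>\<^bsub>\<F>\<^esub> embed g"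
proof (rule embed_eqI)
  fix q :: rat assume "0 < q" "(embed f \<oplus>\<^bsub>\<F>\<^esub> embed g) q \<noteq> \<zero>"
  then have "embed f q \<noteq> \<zero> \<or> embed g q \<noteq> \<zero>" by auto
  then show "\<exists>m. q = of_nat (prime_val m)"
    using \<open>0 < q\<close> embed_nonzeroE by metis
next
  show "(embed f \<oplus>\<^bsub>\<F>\<^esub> embed g) (of_nat (prime_val m)) = (f \<oplus>\<^bsub>\<P>\<^esub> g) m" for m
    by (simp, simp add: powser_algebra_def)
qed (use assms in \<open>simp_all add: \<P>_closed \<F>_closed embed_closed\<close>)

lemma embed_smult:
  assumes "r \<in> carrier R" "f \<in> carrier \<P>"
  shows "embed (r \<odot>\<^bsub>\<P>\<^esub> f) = r \<odot>\<^bsub>\<F>\<^esub> embed f"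
proof (rule embed_eqI)
  fix q :: rat assume "0 < q" "(r \<odot>\<^bsub>\<F>\<^esub> embed f) q \<noteq> \<zero>"
  then have "embed f q \<noteq> \<zero>" using assms by auto
  then show "\<exists>m. q = of_nat (prime_val m)"
    using \<open>0 < q\<close> embed_nonzeroE by metis
next
  show "(r \<odot>\<^bsub>\<F>\<^esub> embed f) (of_nat (prime_val m)) = (r \<odot>\<^bsub>\<P>\<^esub> f) m" for m
    by (simp, simp add: powser_algebra_def)
qed (use assms in \<open>simp_all add: \<P>_closed \<F>_closed embed_closed\<close>)

lemma embed_mult:
  assumes f: "f \<in> carrier \<P>" and g: "g \<in> carrier \<P>"
  shows "embed (f \<otimes>\<^bsub>\<P>\<^esub> g) = embed f \<otimes>\<^bsub>\<F>\<^esub> embed g"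
proof (rule embed_eqI)
  have E: "embed f \<in> {0<..} \<rightarrow>\<^sub>E carrier R" "embed g \<in> {0<..} \<rightarrow>\<^sub>E carrier R"
    using embed_closed assms by (auto simp: carrier_\<F>)
  {
    fix q :: rat assume q: "0 < q" "(embed f \<otimes>\<^bsub>\<F>\<^esub> embed g) q \<noteq> \<zero>"
    then obtain p where p: "0 < p" "embed f p \<noteq> \<zero>" "embed g (q / p) \<noteq> \<zero>"
      using \<F>_mult_nonzeroE[OF E] by blast
    obtain m where m: "p = of_nat (prime_val m)"
      using p embed_nonzeroE by blast
    obtain n where n: "q / p = of_nat (prime_val n)"
      using p q embed_nonzeroE[of "q / p" g] by auto
    have "q = p * (q / p)"
      using p by simp
    also have "\<dots> = of_nat (prime_val (m + n))"
      unfolding n unfolding m by (simp add: prime_val_add)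
    finally show "\<exists>m. q = of_nat (prime_val m)" ..
  }
  fix m :: "nat \<Rightarrow>\<^sub>0 nat"
  let ?q = "of_nat (prime_val m) :: rat" and ?P = "{p. fst p + snd p = m}"
  let ?v = "\<lambda>p :: (nat \<Rightarrow>\<^sub>0 nat) \<times> (nat \<Rightarrow>\<^sub>0 nat). of_nat (prime_val (fst p)) :: rat"
  have div: "?q / ?v p = of_nat (prime_val (snd p))" if "p \<in> ?P" for p
    using that by (auto simp: prime_val_add)
  have "(embed f \<otimes>\<^bsub>\<F>\<^esub> embed g) ?q = (\<Oplus>r\<in>?v ` ?P. embed f r \<otimes> embed g (?q / r))"
  proof (rule mult_eq_finsum[OF E])
    fix r assume r: "0 < r" "embed f r \<noteq> \<zero>" "embed g (?q / r) \<noteq> \<zero>"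
    obtain a where a: "r = of_nat (prime_val a)"
      using r embed_nonzeroE by blast
    obtain b where b: "?q / r = of_nat (prime_val b)"
      using r embed_nonzeroE[of "?q / r" g] by auto
    have "?q = r * (?q / r)"
      using r by simp
    also have "\<dots> = of_nat (prime_val (a + b))"
      unfolding b unfolding a by (simp add: prime_val_add)
    finally have "a + b = m"
      by simp
    then show "r \<in> ?v ` ?P"
      using a by (intro image_eqI[of _ _ "(a, b)"]) auto
  qed (auto simp: finite_pairs_sum_eq)
  also have "\<dots> = (\<Oplus>p\<in>?P. embed f (?v p) \<otimes> embed g (?q / ?v p))"
    using f g by (subst finsum_reindex) (auto simp: inj_on_def prime_val_add powser_algebra_def Pi_iff)
  also have "\<dots> = (\<Oplus>p\<in>?P. f (fst p) \<otimes> g (snd p))"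
  proof (rule finsum_cong')
    show "(\<lambda>p. f (fst p) \<otimes> g (snd p)) \<in> ?P \<rightarrow> carrier R"
      using f g by (auto simp: powser_algebra_def)
    show "embed f (?v p) \<otimes> embed g (?q / ?v p) = f (fst p) \<otimes> g (snd p)" if "p \<in> ?P" for p
      using div[OF that] by simp
  qed simp
  also have "\<dots> = (f \<otimes>\<^bsub>\<P>\<^esub> g) m"
    by (simp add: powser_algebra_def)
  finally show "(embed f \<otimes>\<^bsub>\<F>\<^esub> embed g) ?q = (f \<otimes>\<^bsub>\<P>\<^esub> g) m" .
qed (use assms in \<open>auto simp: \<P>_closed \<F>_closed embed_closed\<close>)

lemma algebra_\<P>: "algebra R \<P>"
  by (rule algebra_pullback[OF algebra_\<F>, where h = embed])
     (use inj_embed in \<open>auto simp: embed_closed \<P>_closed embed_one embed_zero embed_add embed_mult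
        embed_smult intro: inj_on_subset\<close>)

section \<open>Inverting the monomials\<close>

lemma monomialsE:
  assumes "s \<in> monomials R"
  obtains n where "s = (\<lambda>m. if m = n then \<one> else \<zero>)"
  using assms by (auto simp: monomials_def)

lemma monomials_closed: "monomials R \<subseteq> carrier \<P>"
  by (auto simp: monomials_def powser_algebra_def)

lemma mult_monomials:
  assumes "s \<in> monomials R" "t \<in> monomials R"
  shows "s \<otimes>\<^bsub>\<P>\<^esub> t \<in> monomials R"
proof -
  obtain k where s: "s = (\<lambda>m. if m = k then \<one> else \<zero>)"
    using assms(1) by (rule monomialsE)
  obtain l where t: "t = (\<lambda>m. if m = l then \<one> else \<zero>)"
    using assms(2) by (rule monomialsE)
  have "embed (s \<otimes>\<^bsub>\<P>\<^esub> t) = embed s \<otimes>\<^bsub>\<F>\<^esub> embed t"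
    using assms monomials_closed by (intro embed_mult) auto
  also have "\<dots> = embed (\<lambda>m. if m = k + l then \<one> else \<zero>)"
    by (simp add: s t embed_delta delta_mult_delta prime_val_add)
  finally have "s \<otimes>\<^bsub>\<P>\<^esub> t = (\<lambda>m. if m = k + l then \<one> else \<zero>)"
    using inj_embed by (simp add: inj_eq)
  then show ?thesis
    by (auto simp: monomials_def)
qed

lemma delta_Units:
  assumes "0 < a"
  shows "delta a \<in> Units \<F>"
  unfolding Units_def using assms
  by (auto intro!: delta_closed bexI[of _ "delta (1 / a)"] simp: delta_mult_delta delta_1)

text \<open>The monomial is the one that corresponds to a common denominator of the support of \<open>\<alpha>\<close>.\<close>

lemma clear_denominator:
  assumes \<alpha>: "\<alpha> \<in> carrier \<F>"
  shows "\<exists>s\<in>monomials R. \<exists>f\<in>carrier \<P>. embed f = embed s \<otimes>\<^bsub>\<F>\<^esub> \<alpha>"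
proof -
  obtain d where d: "has_denom R \<alpha> d"
    using \<alpha> by (auto simp: carrier_\<F>)
  then have "0 < d" by (simp add: has_denom_def)
  then obtain n where n: "prime_val n = d"
    using prime_val_surj by blast
  let ?s = "\<lambda>m. if m = n then \<one> else \<zero>"
  let ?f = "\<lambda>m. \<alpha> (of_nat (prime_val m) / of_nat d)"
  have "embed ?f = delta (of_nat d) \<otimes>\<^bsub>\<F>\<^esub> \<alpha>"
  proof (rule embed_eqI)
    fix q :: rat assume q: "0 < q" "(delta (of_nat d) \<otimes>\<^bsub>\<F>\<^esub> \<alpha>) q \<noteq> \<zero>"
    then have "\<alpha> (q / of_nat d) \<noteq> \<zero>"
      using \<alpha> \<open>0 < d\<close> by (simp add: delta_mult)
    then obtain k :: nat where "0 < k" "of_nat d * (q / of_nat d) = of_nat k"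
      using has_denomE[OF d, of "q / of_nat d"] q \<open>0 < d\<close> by auto
    then show "\<exists>m. q = of_nat (prime_val m)"
      using prime_val_surj[of k] \<open>0 < d\<close> by (metis nonzero_mult_div_cancel_left of_nat_0_eq_iff
        less_numeral_extra(3) times_divide_eq_right)
  qed (use \<alpha> \<open>0 < d\<close> in \<open>auto simp: delta_mult delta_closed \<F>_closed powser_algebra_def\<close>)
  moreover have "embed ?s = delta (of_nat d)"
    by (simp add: embed_delta n)
  moreover have "?s \<in> monomials R" "?f \<in> carrier \<P>"
    using \<alpha> \<open>0 < d\<close> by (auto simp: monomials_def powser_algebra_def)
  ultimately show ?thesis
    by metis
qed

end

theorem proposition3p6:
  fixes R :: "('a, 'm) ring_scheme"
  assumes "cring R"
  shows "algebra R (rat_fun_algebra R) \<and>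
    algebra R (localization (powser_algebra R) (monomials R)) \<and>
    (\<exists>\<phi>. \<phi> \<in> algebra_iso R (rat_fun_algebra R)
                (localization (powser_algebra R) (monomials R)))"
proof -
  interpret cring R by fact
  have hom: "embed \<in> ring_hom \<P> \<F>"
    by (rule ring_hom_memI) (auto simp: embed_closed embed_mult embed_add embed_one)
  have one: "\<one>\<^bsub>\<P>\<^esub> \<in> monomials R"
    by (auto simp: monomials_def powser_algebra_def)
  have units: "embed s \<in> Units \<F>" if "s \<in> monomials R" for s
    using that by (auto elim!: monomialsE simp: embed_delta intro!: delta_Units)
  note loc = localization_iso[OF algebra_\<P> algebra_\<F> hom inj_on_subset[OF inj_embed subset_UNIV]
      embed_smult monomials_closed one mult_monomials units clear_denominator]
  show ?thesis
    using algebra_\<F> loc by blast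
qed

end
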